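(* Let $\mathcal T$ be a face-connected $n$-dimensional finite triangulation in $\mathbb R^n$ and let the domain $\Omega$ be the interior of the underlying set of $\mathcal T$. Let $1\le p,q\le\infty$ with $1=1/p+1/q$, and suppose that $u,w\in W^{1,p}(\Omega)$ with $\nabla w=\nabla u$. Suppose that the $n$-simplices of $\mathcal T$ are enumerated as $T_0,T_1,\dots,T_M$, and that for each $1\le m\le M$ there is an index $0\le\varpi(m)\le m-1$ such that, with nonnegative real constants $A_0,\dots,A_M$, $A'_1,\dots,A'_M$, $B_1,\dots,B_M$, $$\|w\|_{L^p(T_0)}\le A_0\|\nabla u\|_{L^p(T_0)},$$ $$\|w\|_{L^p(T_m)}\le A_m\|\nabla u\|_{L^p(T_m)}+A'_m\|\nabla u\|_{L^p(T_{\varpi(m)})}+B_m\|w\|_{L^p(T_{\varpi(m)})},\qquad 1\le m\le M.$$ For each $0\le m\le M$ let $0=j_{m,0}<j_{m,1}<\dots<j_{m,L(m)}=m$ be the sequence obtained by repeatedly applying $\varpi$ starting from $m$ until index $0$ is reached, so $j_{m,\ell-1}=\varpi(j_{m,\ell})$ for $1\le\ell\le L(m)$ (and $L(0)=0$). Set $C_{m,L(m)}:=A_m$ and, for $0\le\ell\le L(m)-1$, $$C_{m,\ell}:=\big(B_{j_{m,L(m)}}B_{j_{m,L(m)-1}}\cdots B_{j_{m,\ell+2}}\big)\big(B_{j_{m,\ell+1}}A_{j_{m,\ell}}+A'_{j_{m,\ell+1}}\big),$$ where an empty product equals $1$. Then $$\|w\|_{L^p(\Omega)}\le\left(\sum_{m=0}^M\Big(\sum_{\ell=0}^{L(m)}C_{m,\ell}^q\Big)^{p/q}\right)^{1/p}\|\nabla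 u\|_{L^p(\Omega)},$$ where the constant is read as $\sum_{m}\max_\ell C_{m,\ell}$ if $p=1$ and as $\max_m\sum_\ell C_{m,\ell}$ if $p=\infty$.
   Context: A triangulation (simplicial complex) is a finite family of simplices containing all subsimplices of its members and such that any non-empty intersection of two members is a common subsimplex of both. It is $n$-dimensional if every member is contained in an $n$-dimensional member; its underlying set is the union of its members. Two $n$-simplices are face-neighboring if their intersection is a common $(n-1)$-dimensional subsimplex; the triangulation is face-connected if any two $n$-simplices are joined by a sequence of $n$-simplices in which consecutive ones are face-neighboring. $\|\nabla u\|_{L^p}$ is the $L^p$ norm of the pointwise Euclidean norm. *)

theory Defs
  imports "HOL-Analysis.Analysis" "HOL-Probability.Essential_Supremum"
begin

section \<open>Triangulations\<close>

text \<open>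
  Simplicial complexes are those of the library.  The library counts the empty set as a
  \<open>-1\<close>-simplex and as a face of every simplex, so a nonempty complex also contains \<open>{}\<close>; this is
  why no special case for empty intersections is needed.  Adding or removing \<open>{}\<close> changes neither
  the underlying set nor the top-dimensional simplices.
\<close>

definition dim_triangulation :: "nat \<Rightarrow> 'a::euclidean_space set set \<Rightarrow> bool" where
  "dim_triangulation n K \<longleftrightarrow>
     simplicial_complex K \<and> (\<forall>S\<in>K. \<exists>T\<in>K. int n simplex T \<and> S \<subseteq> T)"

definition top_simplices :: "nat \<Rightarrow> 'a::euclidean_space set set \<Rightarrow> 'a set set" where
  "top_simplices n K = {S \<in> K. int n simplex S}"

definition face_neighboring :: "nat \<Rightarrow> 'a::euclidean_space set \<Rightarrow> 'a set \<Rightarrow> bool" where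
  "face_neighboring n S T \<longleftrightarrow>
     (int n - 1) simplex (S \<inter> T) \<and> (S \<inter> T) face_of S \<and> (S \<inter> T) face_of T"

definition face_connected :: "nat \<Rightarrow> 'a::euclidean_space set set \<Rightarrow> bool" where
  "face_connected n K \<longleftrightarrow>
     (\<forall>S\<in>top_simplices n K. \<forall>T\<in>top_simplices n K.
        (\<lambda>X Y. X \<in> top_simplices n K \<and> Y \<in> top_simplices n K \<and> face_neighboring n X Y)\<^sup>*\<^sup>* S T)"


section \<open>Lebesgue spaces\<close>

definition Lp_space ::
  "ennreal \<Rightarrow> 'a::euclidean_space set \<Rightarrow> ('a \<Rightarrow> 'b::euclidean_space) set" where
  "Lp_space p S = {f \<in> borel_measurable (lebesgue_on S).
     if p = \<infinity> then esssup (lebesgue_on S) (\<lambda>x. ennreal (norm (f x))) < \<infinity>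
     else integrable (lebesgue_on S) (\<lambda>x. norm (f x) powr enn2real p)}"

text \<open>Real-valued, hence only meaningful for members of the corresponding space.\<close>

definition Lp_norm ::
  "ennreal \<Rightarrow> 'a::euclidean_space set \<Rightarrow> ('a \<Rightarrow> 'b::euclidean_space) \<Rightarrow> real" where
  "Lp_norm p S f =
     (if p = \<infinity> then enn2real (esssup (lebesgue_on S) (\<lambda>x. ennreal (norm (f x))))
      else (LINT x|lebesgue_on S. norm (f x) powr enn2real p) powr (1 / enn2real p))"


section \<open>Weak gradients and first-order Sobolev spaces\<close>

definition partial_deriv :: "'n::finite \<Rightarrow> (real^'n \<Rightarrow> real) \<Rightarrow> real^'n \<Rightarrow> real" where
  "partial_deriv i f x = frechet_derivative f (at x) (axis i 1)"

primrec continuously_differentiable_upto :: "nat \<Rightarrow> (real^'n::finite \<Rightarrow> real) \<Rightarrow> bool" where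
  "continuously_differentiable_upto 0 f \<longleftrightarrow> continuous_on UNIV f"
| "continuously_differentiable_upto (Suc k) f \<longleftrightarrow>
     (\<forall>x. f differentiable (at x)) \<and> (\<forall>i. continuously_differentiable_upto k (partial_deriv i f))"

definition test_functions :: "(real^'n::finite) set \<Rightarrow> (real^'n \<Rightarrow> real) set" where
  "test_functions \<Omega> = {\<phi>. (\<forall>k. continuously_differentiable_upto k \<phi>) \<and>
     compact (closure {x. \<phi> x \<noteq> 0}) \<and> closure {x. \<phi> x \<noteq> 0} \<subseteq> \<Omega>}"

definition locally_integrable_on ::
  "('a::euclidean_space \<Rightarrow> 'b::euclidean_space) \<Rightarrow> 'a set \<Rightarrow> bool" where
  "locally_integrable_on f \<Omega> \<longleftrightarrow> (\<forall>K. compact K \<and> K \<subseteq> \<Omega> \<longrightarrow> integrable (lebesgue_on K) f)"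

definition has_weak_gradient ::
  "(real^'n::finite) set \<Rightarrow> (real^'n \<Rightarrow> real) \<Rightarrow> (real^'n \<Rightarrow> real^'n) \<Rightarrow> bool" where
  "has_weak_gradient \<Omega> u g \<longleftrightarrow>
     locally_integrable_on u \<Omega> \<and> locally_integrable_on g \<Omega> \<and>
     (\<forall>\<phi>\<in>test_functions \<Omega>. \<forall>i.
        (LINT x|lebesgue_on \<Omega>. u x * partial_deriv i \<phi> x) =
        - (LINT x|lebesgue_on \<Omega>. (g x $ i) * \<phi> x))"

text \<open>A representative; weak gradients are unique almost everywhere.\<close>

definition weak_grad ::
  "(real^'n::finite) set \<Rightarrow> (real^'n \<Rightarrow> real) \<Rightarrow> real^'n \<Rightarrow> real^'n" where
  "weak_grad \<Omega> u = (SOME g. has_weak_gradient \<Omega> u g)"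

definition Sobolev_W1 :: "ennreal \<Rightarrow> (real^'n::finite) set \<Rightarrow> (real^'n \<Rightarrow> real) set" where
  "Sobolev_W1 p \<Omega> = {u \<in> Lp_space p \<Omega>.
     (\<exists>g. has_weak_gradient \<Omega> u g) \<and> weak_grad \<Omega> u \<in> Lp_space p \<Omega>}"


section \<open>The chains of simplices and the constants\<close>

text \<open>
  The predecessor map $\varpi$ of the text is \<open>par\<close>;
  \<open>chain_len par m\<close> and \<open>chain_idx par m l\<close> are $L(m)$ and $j_{m,l}$.  They are used only when
  \<open>par k < k\<close> for all \<open>1 \<le> k \<le> m\<close>; the lemmas below then characterize them.
\<close>

definition chain_len :: "(nat \<Rightarrow> nat) \<Rightarrow> nat \<Rightarrow> nat" where
  "chain_len par m = (LEAST k. (par ^^ k) m = 0)"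

definition chain_idx :: "(nat \<Rightarrow> nat) \<Rightarrow> nat \<Rightarrow> nat \<Rightarrow> nat" where
  "chain_idx par m l = (par ^^ (chain_len par m - l)) m"

lemma chain_len_0: "chain_len par 0 = 0"
  unfolding chain_len_def by (rule Least_eq_0) simp

lemma chain_idx_last: "chain_idx par m (chain_len par m) = m"
  by (simp add: chain_idx_def)

lemma chain_idx_step:
  assumes "1 \<le> l" "l \<le> chain_len par m"
  shows "chain_idx par m (l - 1) = par (chain_idx par m l)"
proof -
  have "chain_len par m - (l - 1) = Suc (chain_len par m - l)"
    using assms by linarith
  then show ?thesis
    by (simp add: chain_idx_def)
qed

lemma chain_reaches_0:
  fixes par :: "nat \<Rightarrow> nat"
  assumes "\<And>k. 1 \<le> k \<Longrightarrow> k \<le> m \<Longrightarrow> par k < k"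
  shows "\<exists>k. (par ^^ k) m = 0"
  using assms
proof (induction m rule: less_induct)
  case (less m)
  show ?case
  proof (cases "m = 0")
    case True
    then have "(par ^^ 0) m = 0" by simp
    then show ?thesis by blast
  next
    case False
    then have lt: "par m < m" using less.prems[of m] by simp
    have "\<exists>k. (par ^^ k) (par m) = 0"
      using lt less.prems by (intro less.IH) auto
    then obtain k where "(par ^^ k) (par m) = 0" by blast
    then have "(par ^^ Suc k) m = 0"
      by (simp add: funpow_swap1)
    then show ?thesis by blast
  qed
qed

lemma chain_idx_first:
  assumes "\<And>k. 1 \<le> k \<Longrightarrow> k \<le> m \<Longrightarrow> par k < k"
  shows "chain_idx par m 0 = 0"
  using LeastI_ex[OF chain_reaches_0[OF assms]]
  by (simp add: chain_idx_def chain_len_def)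

lemma chain_idx_pos:
  assumes "1 \<le> l" "l \<le> chain_len par m"
  shows "chain_idx par m l > 0"
proof -
  have "chain_len par m - l < (LEAST k. (par ^^ k) m = 0)"
    using assms unfolding chain_len_def by linarith
  from not_less_Least[OF this] show ?thesis
    by (simp add: chain_idx_def)
qed

definition chain_const ::
  "(nat \<Rightarrow> nat) \<Rightarrow> (nat \<Rightarrow> real) \<Rightarrow> (nat \<Rightarrow> real) \<Rightarrow> (nat \<Rightarrow> real) \<Rightarrow> nat \<Rightarrow> nat \<Rightarrow> real" where
  "chain_const par A A' B m l =
     (if l = chain_len par m then A m
      else (\<Prod>k = l + 2..chain_len par m. B (chain_idx par m k)) *
           (B (chain_idx par m (l + 1)) * A (chain_idx par m l) + A' (chain_idx par m (l + 1))))"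

definition total_const ::
  "ennreal \<Rightarrow> ennreal \<Rightarrow> nat \<Rightarrow> (nat \<Rightarrow> nat) \<Rightarrow>
   (nat \<Rightarrow> real) \<Rightarrow> (nat \<Rightarrow> real) \<Rightarrow> (nat \<Rightarrow> real) \<Rightarrow> real" where
  "total_const p q M par A A' B =
     (if p = 1 then
        (\<Sum>m = 0..M. Max ((\<lambda>l. chain_const par A A' B m l) ` {0..chain_len par m}))
      else if p = \<infinity> then
        Max ((\<lambda>m. \<Sum>l = 0..chain_len par m. chain_const par A A' B m l) ` {0..M})
      else
        (\<Sum>m = 0..M. (\<Sum>l = 0..chain_len par m. chain_const par A A' B m l powr enn2real q)
                      powr (enn2real p / enn2real q)) powr (1 / enn2real p))"

end

theory Submission
  imports Defs
begin

text \<open>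
  Unrolling the recursive estimate along the chain from \<open>m\<close> down to \<open>0\<close> gives
  \<open>\<parallel>w\<parallel>(T\<^sub>m) \<le> (\<Sum>l. C\<^sub>m\<^sub>l * \<parallel>\<nabla>u\<parallel>(T\<^sub>j))\<close> with \<open>j = j\<^sub>m\<^sub>l\<close>.  The simplices of one chain are distinct and
  distinct top-dimensional simplices overlap only in a null set, so Hoelder's inequality bounds
  the sum by \<open>(\<Sum>l. C\<^sub>m\<^sub>l\<^sup>q)\<close> to the power \<open>1/q\<close> times the norm of \<open>\<nabla>u\<close> over all of \<open>\<Omega>\<close>.  Since the
  simplices also cover \<open>\<Omega>\<close> up to a null set, summing the \<open>p\<close>-th powers over \<open>m\<close> (taking the maximum
  if \<open>p = \<infinity>\<close>) gives the claim.
\<close>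

section \<open>Predecessor chains and the unrolled recursion\<close>

lemma chain_len_step:
  fixes par :: "nat \<Rightarrow> nat"
  assumes "\<And>k. 1 \<le> k \<Longrightarrow> k \<le> m \<Longrightarrow> par k < k" "1 \<le> m"
  shows "chain_len par m = Suc (chain_len par (par m))"
proof -
  obtain k where k: "(par ^^ k) m = 0"
    using chain_reaches_0[of m par] assms(1) by blast
  have "(LEAST k. (par ^^ k) m = 0) = Suc (LEAST k. (par ^^ Suc k) m = 0)"
    using assms(2) by (intro Least_Suc[where P = "\<lambda>k. (par ^^ k) m = 0", OF k]) auto
  then show ?thesis
    by (simp add: chain_len_def funpow_swap1)
qed

text \<open>Positions are counted from the root, so replacing \<open>m\<close> by its predecessor
  drops the last entry of the chain and leaves every other position unchanged.\<close>

lemma chain_idx_parent: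
  assumes "\<And>k. 1 \<le> k \<Longrightarrow> k \<le> m \<Longrightarrow> par k < k" "1 \<le> m" "l \<le> chain_len par (par m)"
  shows "chain_idx par m l = chain_idx par (par m) l"
proof -
  have "chain_len par m - l = Suc (chain_len par (par m) - l)"
    using chain_len_step[of m par] assms by simp
  then show ?thesis
    by (simp add: chain_idx_def funpow_swap1)
qed

text \<open>Before the first hitting time of 0 every iterate is nonzero, so \<open>par\<close>
  strictly decreases it; nothing is assumed about \<open>par 0\<close>, hence only iterates up to
  that time are considered. For \<open>l\<close> beyond the chain length the truncated subtraction
  yields \<open>m\<close> itself.\<close>

lemma chain_idx_le:
  assumes "\<And>k. 1 \<le> k \<Longrightarrow> k \<le> m \<Longrightarrow> par k < k"
  shows "chain_idx par m l \<le> m"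
proof -
  have "(par ^^ i) m \<le> m" if "i \<le> chain_len par m" for i
    using that
  proof (induction i)
    case (Suc i)
    then have "(par ^^ i) m \<noteq> 0"
      using not_less_Least[of i "\<lambda>k. (par ^^ k) m = 0"] by (simp add: chain_len_def)
    then have "par ((par ^^ i) m) < (par ^^ i) m"
      using Suc by (intro assms) auto
    then show ?case
      using Suc by simp
  qed simp
  then show ?thesis
    by (simp add: chain_idx_def)
qed

text \<open>This gives injectivity: no simplex occurs twice in a chain, so a sum of nonnegative
  terms along the chain is at most the sum over all simplices.\<close>

lemma chain_idx_strict_mono_on:
  assumes "\<And>k. 1 \<le> k \<Longrightarrow> k \<le> m \<Longrightarrow> par k < k"
  shows "strict_mono_on {0..chain_len par m} (chain_idx par m)"
proof (rule strict_mono_onI)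
  fix i j assume "i \<in> {0..chain_len par m}" "j \<in> {0..chain_len par m}" "i < j"
  from this(2,3) show "chain_idx par m i < chain_idx par m j"
  proof (induction j)
    case (Suc j)
    then have j: "1 \<le> Suc j" "Suc j \<le> chain_len par m"
      by auto
    have "chain_idx par m j = par (chain_idx par m (Suc j))"
      using chain_idx_step[OF j] by simp
    also have "\<dots> < chain_idx par m (Suc j)"
      using chain_idx_pos[OF j] chain_idx_le[of m par "Suc j"] assms by auto
    finally have "chain_idx par m j < chain_idx par m (Suc j)" .
    then show ?case
      using Suc by (cases "i = j") auto
  qed simp
qed

text \<open>The chain of \<open>m\<close> extends that of \<open>par m\<close> by the entry
  \<open>m\<close> alone, so the product gains the single factor \<open>B m\<close>. The last
  position of the shorter chain is excluded, because there the constant is given by the separate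
  case \<open>A\<close>.\<close>

lemma chain_const_parent:
  assumes "\<And>k. 1 \<le> k \<Longrightarrow> k \<le> m \<Longrightarrow> par k < k" "1 \<le> m" "l < chain_len par (par m)"
  shows "chain_const par A A' B m l = B m * chain_const par A A' B (par m) l"
proof -
  let ?L = "chain_len par (par m)"
  have L: "chain_len par m = Suc ?L"
    by (rule chain_len_step[OF assms(1,2)])
  \<comment> \<open>The top factor can be split off because \<open>l < ?L\<close> makes the range
    nonempty; its index is \<open>m\<close>, which produces \<open>B m\<close>.\<close>
  have "(\<Prod>k = l + 2..Suc ?L. B (chain_idx par m k))
      = (\<Prod>k = l + 2..?L. B (chain_idx par m k)) * B (chain_idx par m (Suc ?L))"
    using assms(3) by (simp add: prod.nat_ivl_Suc')
  moreover have "(\<Prod>k = l + 2..?L. B (chain_idx par m k)) = (\<Prod>k = l + 2..?L. B (chain_idx par (par m) k))"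
    by (intro prod.cong refl arg_cong[of _ _ B] chain_idx_parent[OF assms(1,2)]) auto
  ultimately show ?thesis
    using assms(3) chain_idx_last[of par m] chain_idx_parent[OF assms(1,2), of l]
      chain_idx_parent[OF assms(1,2), of "l + 1"]
    by (simp add: chain_const_def L del: prod.cl_ivl_Suc)
qed

lemma chain_const_nonneg:
  assumes "\<And>k. 1 \<le> k \<Longrightarrow> k \<le> m \<Longrightarrow> par k < k"
    and "\<And>k. k \<le> m \<Longrightarrow> 0 \<le> A k"
    and "\<And>k. 1 \<le> k \<Longrightarrow> k \<le> m \<Longrightarrow> 0 \<le> A' k"
    and "\<And>k. 1 \<le> k \<Longrightarrow> k \<le> m \<Longrightarrow> 0 \<le> B k"
    and "l \<le> chain_len par m"
  shows "0 \<le> chain_const par A A' B m l"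
proof -
  have "0 \<le> B (chain_idx par m k) \<and> 0 \<le> A' (chain_idx par m k)"
    if "1 \<le> k" "k \<le> chain_len par m" for k
    using chain_idx_pos[OF that] chain_idx_le[OF assms(1)] by (auto intro!: assms(3,4))
  then show ?thesis
    using assms(2,5) chain_idx_le[OF assms(1)]
    by (auto simp: chain_const_def intro!: mult_nonneg_nonneg add_nonneg_nonneg prod_nonneg)
qed

text \<open>Induction along the chain: the bound for \<open>W (par m)\<close> is inserted into the
  recursive estimate, which preserves the inequality since \<open>B m\<close> is
  nonnegative.\<close>

lemma chain_bound:
  fixes W G :: "nat \<Rightarrow> real"
  assumes "\<And>k. 1 \<le> k \<Longrightarrow> k \<le> m \<Longrightarrow> par k < k"
    and "\<And>k. 1 \<le> k \<Longrightarrow> k \<le> m \<Longrightarrow> 0 \<le> B k"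
    and "W 0 \<le> A 0 * G 0"
    and "\<And>k. 1 \<le> k \<Longrightarrow> k \<le> m \<Longrightarrow> W k \<le> A k * G k + A' k * G (par k) + B k * W (par k)"
  shows "W m \<le> (\<Sum>l = 0..chain_len par m. chain_const par A A' B m l * G (chain_idx par m l))"
  using assms
proof (induction m rule: less_induct)
  case (less m)
  show ?case
  proof (cases "m = 0")
    case True
    then show ?thesis
      using less.prems(3) chain_idx_last[of par 0]
      by (simp add: chain_len_0 chain_const_def)
  next
    case False
    then have m: "1 \<le> m" "par m < m" using less.prems(1)[of m] by auto
    let ?n = "par m" and ?C = "chain_const par A A' B"
    let ?L = "chain_len par ?n"
    note par = less.prems(1)
    have L: "chain_len par m = Suc ?L"
      by (rule chain_len_step[OF par m(1)])
    have last: "chain_idx par m (Suc ?L) = m" "chain_idx par ?n ?L = ?n"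
      using chain_idx_last[of par m] L chain_idx_last[of par ?n] by simp_all
    have last': "chain_idx par m ?L = ?n"
      using chain_idx_parent[OF par m(1), of ?L] last by simp
    \<comment> \<open>The top two positions do not follow the factor rule: \<open>A m\<close> is
      new, and the entry at \<open>par m\<close> picks up the extra summand \<open>A' m\<close>.
      They are therefore split off from the sum.\<close>
    have C: "?C m (Suc ?L) = A m" "?C m ?L = B m * A ?n + A' m" "?C ?n ?L = A ?n"
      by (simp_all add: chain_const_def L last last')
    have IH: "W ?n \<le> (\<Sum>l = 0..?L. ?C ?n l * G (chain_idx par ?n l))"
      by (rule less.IH[OF m(2)]) (use less.prems m in auto)
    have "(\<Sum>l = 0..<?L. ?C m l * G (chain_idx par m l))
        = B m * (\<Sum>l = 0..<?L. ?C ?n l * G (chain_idx par ?n l))"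
      unfolding sum_distrib_left
      by (intro sum.cong refl)
        (simp add: chain_const_parent[OF par m(1)] chain_idx_parent[OF par m(1)])
    moreover have "{0..Suc ?L} = insert (Suc ?L) (insert ?L {0..<?L})" "{0..?L} = insert ?L {0..<?L}"
      by auto
    ultimately have "(\<Sum>l = 0..chain_len par m. ?C m l * G (chain_idx par m l))
        = A m * G m + A' m * G ?n + B m * (\<Sum>l = 0..?L. ?C ?n l * G (chain_idx par ?n l))"
      by (simp add: L C last last' algebra_simps)
    moreover have "B m * W ?n \<le> B m * (\<Sum>l = 0..?L. ?C ?n l * G (chain_idx par ?n l))"
      using IH less.prems(2)[of m] m by (intro mult_left_mono) auto
    ultimately show ?thesis
      using less.prems(4)[of m] m by simp
  qed
qed

section \<open>Hoelder's inequality for finite sums\<close>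

lemma Holder_inequality_sum:
  fixes a b :: "'i \<Rightarrow> real"
  assumes "finite I" "p > 1" "q > 1" "1 / p + 1 / q = 1"
    and nn: "\<And>i. i \<in> I \<Longrightarrow> 0 \<le> a i" "\<And>i. i \<in> I \<Longrightarrow> 0 \<le> b i"
  shows "(\<Sum>i\<in>I. a i * b i) \<le> (\<Sum>i\<in>I. a i powr p) powr (1 / p) * (\<Sum>i\<in>I. b i powr q) powr (1 / q)"
proof -
  let ?X = "\<Sum>i\<in>I. a i powr p" and ?Y = "\<Sum>i\<in>I. b i powr q"
  have X0: "?X \<ge> 0" and Y0: "?Y \<ge> 0" by (auto intro: sum_nonneg)
  show ?thesis
  proof (cases "?X = 0 \<or> ?Y = 0")
    case True
    then have "\<forall>i\<in>I. a i * b i = 0"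
      using assms(1) by (auto simp: sum_nonneg_eq_0_iff)
    then have "(\<Sum>i\<in>I. a i * b i) = 0" by (rule sum.neutral)
    then show ?thesis by simp
  next
    case False
    \<comment> \<open>Both families are scaled to norm 1; Young's inequality applied termwise then
      adds up to \<open>1 / p + 1 / q = 1\<close>.\<close>
    let ?x = "?X powr (1 / p)" and ?y = "?Y powr (1 / q)"
    have pos: "?x > 0" "?y > 0" using False by simp_all
    have xp: "?x powr p = ?X" "?y powr q = ?Y"
      using assms(2,3) X0 Y0 by (simp_all add: powr_powr)
    have "(\<Sum>i\<in>I. (a i / ?x) * (b i / ?y)) \<le> (\<Sum>i\<in>I. (a i / ?x) powr p / p + (b i / ?y) powr q / q)"
      using nn pos by (intro sum_mono Youngs_inequality assms) (auto intro!: divide_nonneg_pos)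
    also have "\<dots> = (\<Sum>i\<in>I. a i powr p / ?X / p + b i powr q / ?Y / q)"
      using nn by (intro sum.cong refl) (simp add: powr_divide xp)
    also have "\<dots> = 1"
      using False assms(4) by (simp add: sum.distrib flip: sum_divide_distrib)
    finally have "(\<Sum>i\<in>I. a i * b i) / (?x * ?y) \<le> 1"
      by (simp add: sum_divide_distrib)
    then show ?thesis
      using pos by (simp add: divide_le_eq)
  qed
qed

section \<open>Lebesgue norms on sets contained or covered up to null sets\<close>

lemma AE_lebesgue_on_ae_subset:
  assumes "AE x in lebesgue_on S. P x" "S \<in> sets lebesgue" "T \<in> sets lebesgue" "negligible (T - S)"
  shows "AE x in lebesgue_on T. P x"
proof -
  have "AE x in lebesgue. x \<notin> T - S"
    using assms(4) AE_not_in negligible_iff_null_sets by blast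
  moreover have "AE x in lebesgue. x \<in> S \<longrightarrow> P x"
    using assms(1,2) by (simp add: AE_restrict_space_iff)
  ultimately have "AE x in lebesgue. x \<in> T \<longrightarrow> P x"
    by eventually_elim auto
  then show ?thesis
    using assms(3) by (simp add: AE_restrict_space_iff)
qed

text \<open>The use is \<open>S\<close> = \<open>\<Omega>\<close> and \<open>T\<close> a closed
  simplex, whose boundary may leave the open set \<open>\<Omega>\<close>, so inclusion holds only up
  to a null set. By completeness of Lebesgue measure the values of \<open>f\<close> on
  \<open>T - S\<close> cannot spoil measurability.\<close>

lemma borel_measurable_lebesgue_on_ae_subset:
  fixes f :: "'a::euclidean_space \<Rightarrow> 'b::euclidean_space"
  assumes "f \<in> borel_measurable (lebesgue_on S)"
    and S: "S \<in> sets lebesgue" and T: "T \<in> sets lebesgue" and "negligible (T - S)"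
  shows "f \<in> borel_measurable (lebesgue_on T)"
proof -
  have "f \<in> borel_measurable (lebesgue_on (S \<inter> T))"
    using measurable_restrict_mono[OF assms(1)] by blast
  then have "(\<lambda>x. if x \<in> S \<inter> T then f x else 0) \<in> borel_measurable lebesgue"
    using S T by (subst borel_measurable_if) auto
  moreover have "AE x in lebesgue. x \<notin> T - S"
    using assms(4) AE_not_in negligible_iff_null_sets by blast
  then have "AE x in lebesgue. (if x \<in> S \<inter> T then f x else 0) = (if x \<in> T then f x else 0)"
    by eventually_elim auto
  ultimately have "(\<lambda>x. if x \<in> T then f x else 0) \<in> borel_measurable lebesgue"
    by (rule borel_measurable_AE)
  then show ?thesis
    by (rule borel_measurable_if_D)
qed

lemma integrable_lebesgue_on_ae_subset:
  fixes f :: "'a::euclidean_space \<Rightarrow> 'b::euclidean_space"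
  assumes "integrable (lebesgue_on S) f"
    and S: "S \<in> sets lebesgue" and T: "T \<in> sets lebesgue" and "negligible (T - S)"
  shows "integrable (lebesgue_on T) f"
proof -
  have "f absolutely_integrable_on S"
    using assms(1) S by (simp add: set_integrable_def integrable_restrict_space)
  then have "f absolutely_integrable_on S \<inter> T"
    by (rule set_integrable_subset) (use S T in auto)
  then have "f absolutely_integrable_on T"
  proof (rule absolutely_integrable_spike_set)
    show "negligible {x \<in> T - S \<inter> T. f x \<noteq> 0}"
      by (rule negligible_subset[OF assms(4)]) auto
  qed simp
  then show ?thesis
    using T by (simp add: set_integrable_def integrable_restrict_space)
qed

lemma esssup_lebesgue_on_ae_subset:
  fixes f :: "'a::euclidean_space \<Rightarrow> 'b::euclidean_space"
  assumes "f \<in> borel_measurable (lebesgue_on S)"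
    and "S \<in> sets lebesgue" "T \<in> sets lebesgue" "negligible (T - S)"
  shows "esssup (lebesgue_on T) (\<lambda>x. ennreal (norm (f x))) \<le> esssup (lebesgue_on S) (\<lambda>x. ennreal (norm (f x)))"
proof (rule esssup_I)
  have "f \<in> borel_measurable (lebesgue_on T)"
    by (rule borel_measurable_lebesgue_on_ae_subset[OF assms])
  then show "(\<lambda>x. ennreal (norm (f x))) \<in> borel_measurable (lebesgue_on T)"
    by measurable
qed (rule AE_lebesgue_on_ae_subset[OF esssup_AE assms(2-4)])

lemma Lp_space_ae_subset:
  assumes "f \<in> Lp_space p S" and ST: "S \<in> sets lebesgue" "T \<in> sets lebesgue" "negligible (T - S)"
  shows "f \<in> Lp_space p T"
proof -
  have f: "f \<in> borel_measurable (lebesgue_on S)"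
    using assms(1) by (simp add: Lp_space_def)
  then have "f \<in> borel_measurable (lebesgue_on T)"
    using ST by (rule borel_measurable_lebesgue_on_ae_subset)
  moreover have "esssup (lebesgue_on T) (\<lambda>x. ennreal (norm (f x))) < \<infinity>" if "p = \<infinity>"
    using le_less_trans[OF esssup_lebesgue_on_ae_subset[OF f ST]] assms(1) that
    by (simp add: Lp_space_def)
  moreover have "integrable (lebesgue_on T) (\<lambda>x. norm (f x) powr enn2real p)" if "p \<noteq> \<infinity>"
    using assms(1) that by (intro integrable_lebesgue_on_ae_subset[OF _ ST]) (simp add: Lp_space_def)
  ultimately show ?thesis
    by (simp add: Lp_space_def)
qed

lemma Lp_norm_nonneg: "0 \<le> Lp_norm p S f"
  by (simp add: Lp_norm_def)

lemma Lp_norm_infinity_ae_subset: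
  assumes "f \<in> Lp_space \<infinity> S" and ST: "S \<in> sets lebesgue" "T \<in> sets lebesgue" "negligible (T - S)"
  shows "Lp_norm \<infinity> T f \<le> Lp_norm \<infinity> S f"
proof -
  have "f \<in> borel_measurable (lebesgue_on S)" "esssup (lebesgue_on S) (\<lambda>x. ennreal (norm (f x))) < \<infinity>"
    using assms(1) by (simp_all add: Lp_space_def)
  with esssup_lebesgue_on_ae_subset[OF _ ST, of f] show ?thesis
    by (simp add: Lp_norm_def enn2real_mono)
qed

text \<open>Finitely many almost-everywhere bounds hold simultaneously almost everywhere, and the
  pieces miss only a null part of \<open>S\<close>.\<close>

lemma Lp_norm_infinity_le_cover:
  assumes "f \<in> Lp_space \<infinity> S" "finite I" "S \<in> sets lebesgue" "\<And>i. i \<in> I \<Longrightarrow> T i \<in> sets lebesgue"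
    and "\<And>i. i \<in> I \<Longrightarrow> negligible (T i - S)" "negligible (S - (\<Union>i\<in>I. T i))"
    and "\<And>i. i \<in> I \<Longrightarrow> Lp_norm \<infinity> (T i) f \<le> c" "0 \<le> c"
  shows "Lp_norm \<infinity> S f \<le> c"
proof -
  have "AE x in lebesgue. x \<in> T i \<longrightarrow> ennreal (norm (f x)) \<le> ennreal c" if i: "i \<in> I" for i
  proof -
    have "f \<in> Lp_space \<infinity> (T i)"
      by (rule Lp_space_ae_subset[OF assms(1,3) assms(4,5)[OF i]])
    \<comment> \<open>Membership in the space matters here: \<open>enn2real\<close> would turn an
      infinite essential supremum into 0.\<close>
    then have "esssup (lebesgue_on (T i)) (\<lambda>x. ennreal (norm (f x))) = ennreal (Lp_norm \<infinity> (T i) f)"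
      by (simp add: Lp_space_def Lp_norm_def)
    also have "\<dots> \<le> ennreal c"
      using assms(7)[OF i] by (rule ennreal_leI)
    finally have "esssup (lebesgue_on (T i)) (\<lambda>x. ennreal (norm (f x))) \<le> ennreal c" .
    then have "AE x in lebesgue_on (T i). ennreal (norm (f x)) \<le> ennreal c"
      using esssup_AE[of "\<lambda>x. ennreal (norm (f x))" "lebesgue_on (T i)"] by (auto elim: order_trans)
    then show ?thesis
      using assms(4)[OF i] by (simp add: AE_restrict_space_iff)
  qed
  then have "AE x in lebesgue. \<forall>i\<in>I. x \<in> T i \<longrightarrow> ennreal (norm (f x)) \<le> ennreal c"
    by (intro AE_finite_allI[OF assms(2)])
  moreover have "AE x in lebesgue. x \<notin> S - (\<Union>i\<in>I. T i)"
    using assms(6) AE_not_in negligible_iff_null_sets by blast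
  ultimately have "AE x in lebesgue. x \<in> S \<longrightarrow> ennreal (norm (f x)) \<le> ennreal c"
    by eventually_elim auto
  then have "AE x in lebesgue_on S. ennreal (norm (f x)) \<le> ennreal c"
    using assms(3) by (simp add: AE_restrict_space_iff)
  moreover have "(\<lambda>x. ennreal (norm (f x))) \<in> borel_measurable (lebesgue_on S)"
    using assms(1) by (auto simp: Lp_space_def)
  ultimately have "esssup (lebesgue_on S) (\<lambda>x. ennreal (norm (f x))) \<le> ennreal c"
    by (rule esssup_I[rotated])
  then show ?thesis
    using assms(8) by (simp add: Lp_norm_def enn2real_leI)
qed

lemma Lp_norm_powr:
  assumes "p \<noteq> \<infinity>" "0 < p"
  shows "Lp_norm p S f powr enn2real p = (LINT x|lebesgue_on S. norm (f x) powr enn2real p)"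
proof -
  \<comment> \<open>\<open>enn2real\<close> sends both 0 and infinity to 0, so both have to be
    excluded before the exponents can cancel.\<close>
  have "enn2real p \<noteq> 0"
    using assms by (auto simp: enn2real_eq_0_iff)
  then show ?thesis
    using assms by (simp add: Lp_norm_def powr_powr integral_nonneg_AE)
qed

text \<open>The \<open>p\<close>-th power of the norm is an integral, hence additive over pieces.
  The argument passes through \<open>has_integral\<close>, which tolerates negligible overlaps of
  the pieces and a negligible mismatch between \<open>S\<close> and their union.\<close>

lemma Lp_norm_powr_partition:
  assumes "f \<in> Lp_space p S" "p \<noteq> \<infinity>" "0 < p"
    and "finite I" "S \<in> sets lebesgue" "\<And>i. i \<in> I \<Longrightarrow> T i \<in> sets lebesgue"
    and "\<And>i. i \<in> I \<Longrightarrow> negligible (T i - S)" "negligible (S - (\<Union>i\<in>I. T i))"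
    and "pairwise (\<lambda>i j. negligible (T i \<inter> T j)) I"
  shows "Lp_norm p S f powr enn2real p = (\<Sum>i\<in>I. Lp_norm p (T i) f powr enn2real p)"
proof -
  let ?h = "\<lambda>x. norm (f x) powr enn2real p"
  have int: "integrable (lebesgue_on S) ?h"
    using assms(1,2) by (simp add: Lp_space_def)
  have "(?h has_integral (\<Sum>i\<in>I. integral\<^sup>L (lebesgue_on (T i)) ?h)) (\<Union>i\<in>I. T i)"
    using assms(4,6,7,9) integrable_lebesgue_on_ae_subset[OF int assms(5)]
    by (intro has_integral_UN has_integral_integral_lebesgue_on) auto
  moreover have "negligible {x \<in> (\<Union>i\<in>I. T i) - S. ?h x \<noteq> 0}"
  proof (rule negligible_subset)
    show "negligible (\<Union>i\<in>I. T i - S)"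
      using assms(4,7) by (intro negligible_Union) auto
  qed auto
  moreover have "negligible {x \<in> S - (\<Union>i\<in>I. T i). ?h x \<noteq> 0}"
    by (rule negligible_subset[OF assms(8)]) auto
  ultimately have "(?h has_integral (\<Sum>i\<in>I. integral\<^sup>L (lebesgue_on (T i)) ?h)) S"
    by (simp only: has_integral_spike_set_eq[of "\<Union>i\<in>I. T i" S])
  moreover have "(?h has_integral (integral\<^sup>L (lebesgue_on S) ?h)) S"
    by (rule has_integral_integral_lebesgue_on[OF int assms(5)])
  ultimately show ?thesis
    using has_integral_unique assms(2,3) by (auto simp: Lp_norm_powr)
qed

section \<open>Geometry of top-dimensional simplices\<close>

lemma top_simplex_convex_compact:
  assumes "S \<in> top_simplices n K"
  shows "convex S" "compact S" "aff_dim S = int n"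
  using assms by (auto simp: top_simplices_def convex_simplex compact_simplex aff_dim_simplex)

text \<open>Two distinct simplices cannot both equal their intersection, so it is a proper face of
  at least one of them. It thus has smaller dimension, and a convex set of deficient dimension has
  empty interior and is null.\<close>

lemma negligible_Int_top_simplices:
  fixes K :: "'a::euclidean_space set set"
  assumes "simplicial_complex K" "S \<in> top_simplices DIM('a) K" "T \<in> top_simplices DIM('a) K" "S \<noteq> T"
  shows "negligible (S \<inter> T)"
proof -
  have "\<forall>S S'. S \<in> K \<and> S' \<in> K \<longrightarrow> (S \<inter> S') face_of S"
    using assms(1) unfolding simplicial_complex_def by blast
  moreover have "S \<in> K" "T \<in> K"
    using assms(2,3) by (simp_all add: top_simplices_def)
  ultimately have face: "(S \<inter> T) face_of S" "(S \<inter> T) face_of T"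
    by (metis, metis Int_commute)
  have "aff_dim (S \<inter> T) < int DIM('a)"
  proof (cases "S \<inter> T = S")
    case True
    then have "S \<inter> T \<noteq> T" using assms(4) by blast
    then show ?thesis
      using face_of_aff_dim_lt[OF _ face(2)] top_simplex_convex_compact[OF assms(3)] by simp
  next
    case False
    then show ?thesis
      using face_of_aff_dim_lt[OF _ face(1)] top_simplex_convex_compact[OF assms(2)] by simp
  qed
  moreover have "convex (S \<inter> T)"
    using assms(2,3) by (intro convex_Int top_simplex_convex_compact)
  ultimately show ?thesis
    using aff_dim_nonempty_interior[of "S \<inter> T"] by (auto simp: negligible_convex_interior)
qed

lemma Union_top_simplices:
  assumes "dim_triangulation n K"
  shows "\<Union>(top_simplices n K) = \<Union>K"
  using assms by (fastforce simp: dim_triangulation_def top_simplices_def)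

text \<open>Points of \<open>S\<close> outside the interior of the union are not interior to
  \<open>S\<close>, so they lie on the frontier of a convex set, which is null.\<close>

lemma negligible_top_simplex_diff:
  assumes "S \<in> top_simplices n K"
  shows "negligible (S - interior (\<Union>K))"
proof (rule negligible_subset[OF negligible_convex_frontier])
  show "convex S"
    by (rule top_simplex_convex_compact[OF assms])
  have "interior S \<subseteq> interior (\<Union>K)"
    using assms by (intro interior_mono) (auto simp: top_simplices_def)
  then show "S - interior (\<Union>K) \<subseteq> frontier S"
    using closure_subset by (auto simp: frontier_def)
qed

section \<open>From chain estimates on the simplices to the global estimate\<close>

theorem theorem4p5:
  fixes K :: "(real^'n) set set"
    and \<Omega> :: "(real^'n) set"
    and p q :: ennreal
    and u w :: "real^'n \<Rightarrow> real"
    and T :: "nat \<Rightarrow> (real^'n) set"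
    and M :: nat
    and par :: "nat \<Rightarrow> nat"
    and A A' B :: "nat \<Rightarrow> real"
  assumes "dim_triangulation CARD('n) K"
    and "face_connected CARD('n) K"
    and "\<Omega> = interior (\<Union>K)"
    and "1 \<le> p" and "1 \<le> q" and "1 = 1 / p + 1 / q"
    and "u \<in> Sobolev_W1 p \<Omega>" and "w \<in> Sobolev_W1 p \<Omega>"
    and "AE x in lebesgue_on \<Omega>. weak_grad \<Omega> w x = weak_grad \<Omega> u x"
    and "bij_betw T {0..M} (top_simplices CARD('n) K)"
    and "\<And>m. 1 \<le> m \<Longrightarrow> m \<le> M \<Longrightarrow> par m \<le> m - 1"
    and "\<And>m. m \<le> M \<Longrightarrow> 0 \<le> A m"
    and "\<And>m. 1 \<le> m \<Longrightarrow> m \<le> M \<Longrightarrow> 0 \<le> A' m"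
    and "\<And>m. 1 \<le> m \<Longrightarrow> m \<le> M \<Longrightarrow> 0 \<le> B m"
    and "Lp_norm p (T 0) w \<le> A 0 * Lp_norm p (T 0) (weak_grad \<Omega> u)"
    and "\<And>m. 1 \<le> m \<Longrightarrow> m \<le> M \<Longrightarrow>
           Lp_norm p (T m) w \<le> A m * Lp_norm p (T m) (weak_grad \<Omega> u)
             + A' m * Lp_norm p (T (par m)) (weak_grad \<Omega> u)
             + B m * Lp_norm p (T (par m)) w"
  shows "Lp_norm p \<Omega> w \<le> total_const p q M par A A' B * Lp_norm p \<Omega> (weak_grad \<Omega> u)"
proof -
  let ?g = "weak_grad \<Omega> u" and ?C = "chain_const par A A' B" and ?L = "chain_len par"
    and ?j = "chain_idx par" and ?P = "enn2real p" and ?Q = "enn2real q"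
  define W G where "W m = Lp_norm p (T m) w" and "G m = Lp_norm p (T m) ?g" for m
  let ?W = "Lp_norm p \<Omega> w" and ?G = "Lp_norm p \<Omega> ?g"
  have W0: "0 \<le> W m" and G0: "0 \<le> G m" and Wt0: "0 \<le> ?W" and Gt0: "0 \<le> ?G" for m
    by (simp_all add: W_def G_def Lp_norm_nonneg)
  have sc: "simplicial_complex K"
    using assms(1) by (simp add: dim_triangulation_def)
  have w: "w \<in> Lp_space p \<Omega>" and g: "?g \<in> Lp_space p \<Omega>"
    using assms(7,8) by (auto simp: Sobolev_W1_def)
  have T: "T i \<in> top_simplices CARD('n) K" if "i \<in> {0..M}" for i
    using assms(10) that by (auto simp: bij_betw_def)
  have UT: "(\<Union>i\<in>{0..M}. T i) = \<Union>K"
    using assms(10) Union_top_simplices[OF assms(1)] by (auto simp: bij_betw_def)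
  have meas: "\<Omega> \<in> sets lebesgue" "\<And>i. i \<in> {0..M} \<Longrightarrow> T i \<in> sets lebesgue"
    using assms(3) top_simplex_convex_compact[OF T] by (auto intro: lmeasurable_compact fmeasurableD)
  have neg: "\<And>i. i \<in> {0..M} \<Longrightarrow> negligible (T i - \<Omega>)" "negligible (\<Omega> - (\<Union>i\<in>{0..M}. T i))"
    using assms(3) negligible_top_simplex_diff[OF T] interior_subset[of "\<Union>K"]
    by (auto simp: UT Diff_eq_empty_iff[THEN iffD2])
  have disj: "pairwise (\<lambda>i j. negligible (T i \<inter> T j)) {0..M}"
  proof (rule pairwiseI)
    fix i j assume ij: "i \<in> {0..M}" "j \<in> {0..M}" "i \<noteq> j"
    then have "T i \<noteq> T j"
      using assms(10) by (auto simp: bij_betw_def inj_on_def)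
    then show "negligible (T i \<inter> T j)"
      using negligible_Int_top_simplices[OF sc, of "T i" "T j"] T[OF ij(1)] T[OF ij(2)] by simp
  qed
  have par: "par k < k" if "1 \<le> k" "k \<le> M" for k
    using assms(11)[OF that] that by simp
  have bound: "W m \<le> (\<Sum>l = 0..?L m. ?C m l * G (?j m l))" if "m \<le> M" for m
    using that assms(14-16) by (intro chain_bound) (auto simp: par W_def G_def)
  have C0: "0 \<le> ?C m l" if "m \<le> M" "l \<in> {0..?L m}" for m l
    using that assms(12-14) by (intro chain_const_nonneg) (auto simp: par)
  have jM: "?j m l \<in> {0..M}" if "m \<le> M" for m l
    using chain_idx_le[of m par l] par that by force
  have p0: "0 < p"
    using assms(4) by (rule less_le_trans[OF zero_less_one])
  \<comment> \<open>The chain is a subfamily of all simplices without repetition, and over all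
    simplices the \<open>p\<close>-th powers add up exactly. The case \<open>p = 1\<close> is
    included.\<close>
  have chain_sum: "(\<Sum>l = 0..?L m. G (?j m l) powr ?P) \<le> ?G powr ?P" if "m \<le> M" "p \<noteq> \<infinity>" for m
  proof -
    have "inj_on (?j m) {0..?L m}"
      using that par by (intro strict_mono_on_imp_inj_on chain_idx_strict_mono_on) auto
    then have "(\<Sum>l = 0..?L m. G (?j m l) powr ?P) = (\<Sum>i\<in>?j m ` {0..?L m}. G i powr ?P)"
      by (simp add: sum.reindex)
    also have "\<dots> \<le> (\<Sum>i\<in>{0..M}. G i powr ?P)"
      using jM[OF that(1)] by (intro sum_mono2) auto
    also have "\<dots> = ?G powr ?P"
      unfolding G_def using p0 that meas neg disj
      by (intro Lp_norm_powr_partition[OF g, symmetric]) auto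
    finally show ?thesis .
  qed
  have W_sum: "?W powr ?P = (\<Sum>m\<in>{0..M}. W m powr ?P)" if "p \<noteq> \<infinity>"
    unfolding W_def using p0 that meas neg disj
    by (intro Lp_norm_powr_partition[OF w]) auto
  consider "p = 1" | "p = \<infinity>" | "p \<noteq> 1" "p \<noteq> \<infinity>" by blast
  then show ?thesis
  proof cases
    case 1
    have "W m \<le> Max (?C m ` {0..?L m}) * ?G" if m: "m \<le> M" for m
    proof -
      \<comment> \<open>The endpoint form of Hoelder's inequality: the constants are replaced by
        their maximum and the gradient norms are summed.\<close>
      have "W m \<le> (\<Sum>l = 0..?L m. Max (?C m ` {0..?L m}) * G (?j m l))"
        using G0 by (intro order.trans[OF bound[OF m]] sum_mono mult_right_mono) auto
      also have "\<dots> \<le> Max (?C m ` {0..?L m}) * ?G"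
        unfolding sum_distrib_left[symmetric]
        using chain_sum[OF m] G0 Gt0 1 C0[OF m] by (intro mult_left_mono) (auto simp: Max_ge_iff)
      finally show ?thesis .
    qed
    then have "(\<Sum>m\<in>{0..M}. W m) \<le> (\<Sum>m\<in>{0..M}. Max (?C m ` {0..?L m}) * ?G)"
      by (intro sum_mono) auto
    then show ?thesis
      using W_sum 1 W0 Wt0 by (simp add: total_const_def sum_distrib_right)
  next
    case 2
    let ?D = "\<lambda>m. \<Sum>l = 0..?L m. ?C m l"
    have D0: "0 \<le> ?D m" if "m \<le> M" for m
      using C0[OF that] by (rule sum_nonneg)
    have D: "?D m \<le> Max (?D ` {0..M})" if "m \<le> M" for m
      using that by auto
    have "W m \<le> Max (?D ` {0..M}) * ?G" if m: "m \<in> {0..M}" for m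
    proof -
      \<comment> \<open>The opposite endpoint: each gradient norm is bounded by the global one,
        which leaves the sum of the constants.\<close>
      have "G (?j m l) \<le> ?G" for l
        using Lp_norm_infinity_ae_subset[of ?g \<Omega> "T (?j m l)"] g 2 meas neg(1) jM m by (auto simp: G_def)
      then have "W m \<le> (\<Sum>l = 0..?L m. ?C m l * ?G)"
        using m C0 by (intro order.trans[OF bound] sum_mono mult_left_mono) auto
      also have "\<dots> \<le> Max (?D ` {0..M}) * ?G"
        unfolding sum_distrib_right[symmetric] using D m Gt0 by (intro mult_right_mono) auto
      finally show ?thesis .
    qed
    moreover have "0 \<le> Max (?D ` {0..M}) * ?G"
      using order_trans[OF D0[of 0] D[of 0]] Gt0 by (intro mult_nonneg_nonneg) simp_all
    ultimately have "?W \<le> Max (?D ` {0..M}) * ?G"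
      using w meas neg unfolding W_def 2
      by - (rule Lp_norm_infinity_le_cover[where I = "{0..M}" and T = T]; (rule finite_atLeastAtMost | assumption))
    then show ?thesis
      using 2 by (simp add: total_const_def)
  next
    case 3
    have p: "p = ennreal ?P" "1 \<le> ?P"
      using 3(2) assms(4) enn2real_mono[of 1 p] by (auto simp: less_top)
    have P_inverse: "1 / p = ennreal (1 / ?P)"
      using p by (metis divide_ennreal ennreal_1 less_le_trans zero_le_one zero_less_one)
    \<comment> \<open>An infinite \<open>q\<close> would force \<open>1 / p = 1\<close>, that is
      \<open>p = 1\<close>, which this case excludes. The exponent relation can then be moved to the
      reals.\<close>
    have "q \<noteq> \<infinity>"
      using assms(6) P_inverse p 3(1) by (auto simp: divide_eq_1_iff)
    then have q: "q = ennreal ?Q" "1 \<le> ?Q"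
      using assms(5) enn2real_mono[of 1 q] by (auto simp: less_top)
    have "1 / q = ennreal (1 / ?Q)"
      using q by (metis divide_ennreal ennreal_1 less_le_trans zero_le_one zero_less_one)
    then have "ennreal (1 / ?P + 1 / ?Q) = 1"
      using assms(6) P_inverse by simp
    then have PQ: "1 / ?P + 1 / ?Q = 1"
      by (simp only: ennreal_eq_1)
    have "1 / ?P > 0" "1 / ?Q > 0"
      using p(2) q(2) by simp_all
    with PQ have "1 / ?P < 1" "1 / ?Q < 1"
      by linarith+
    then have P: "?P > 1" and Q: "?Q > 1"
      using p(2) q(2) by (simp_all add: divide_less_eq)
    let ?S = "\<lambda>m. \<Sum>l = 0..?L m. ?C m l powr ?Q"
    have "W m powr ?P \<le> ?S m powr (?P / ?Q) * ?G powr ?P" if m: "m \<le> M" for m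
    proof -
      \<comment> \<open>Hoelder's inequality with the roles exchanged: the constants carry the
        exponent \<open>?Q\<close> and the gradient norms \<open>?P\<close>.\<close>
      have "W m \<le> ?S m powr (1 / ?Q) * (\<Sum>l = 0..?L m. G (?j m l) powr ?P) powr (1 / ?P)"
        using C0[OF m] G0 P Q PQ
        by (intro order.trans[OF bound[OF m]] Holder_inequality_sum) (auto simp: add.commute)
      also have "\<dots> \<le> ?S m powr (1 / ?Q) * (?G powr ?P) powr (1 / ?P)"
        using chain_sum[OF m 3(2)] P by (intro mult_left_mono powr_mono2 sum_nonneg) auto
      finally have "W m powr ?P \<le> (?S m powr (1 / ?Q) * (?G powr ?P) powr (1 / ?P)) powr ?P"
        using W0 P by (intro powr_mono2) auto
      then show ?thesis
        using P Gt0 by (simp add: powr_mult powr_powr)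
    qed
    then have "?W powr ?P \<le> (\<Sum>m\<in>{0..M}. ?S m powr (?P / ?Q)) * ?G powr ?P"
      unfolding W_sum[OF 3(2)] sum_distrib_right by (intro sum_mono) auto
    \<comment> \<open>Taking the root undoes the powers on both sides since \<open>?W\<close> and
      \<open>?G\<close> are nonnegative.\<close>
    then have "(?W powr ?P) powr (1 / ?P) \<le> ((\<Sum>m\<in>{0..M}. ?S m powr (?P / ?Q)) * ?G powr ?P) powr (1 / ?P)"
      using P by (intro powr_mono2) auto
    then have "?W \<le> (\<Sum>m\<in>{0..M}. ?S m powr (?P / ?Q)) powr (1 / ?P) * ?G"
      using P Wt0 Gt0 by (simp add: powr_mult powr_powr sum_nonneg)
    then show ?thesis
      using 3 by (simp add: total_const_def)
  qed
qed

end
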